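(* Let $r$ and $s$ be natural numbers and set $\alpha = \frac{(r-1)(s-1)}{rs}$. There is an effectively computable constant $C>0$, depending only on $r$ and $s$, such that for every natural number $n$ the interval $[n, n+Cn^{\alpha}]$ contains an integer $m$ which can be written as $m = A^r + B^s$ with $A$ and $B$ integers. *)

theory Defs
  imports Complex_Main
begin

text \<open>
  Kleene's total (general) recursive functions of arity \<open>k\<close>. A \<open>k\<close>-ary function is
  represented on argument lists of length \<open>k\<close>; its values on lists of any other length are
  irrelevant. Minimization is restricted to regular functions, so every function generated is total.
\<close>

inductive general_recursive :: "nat \<Rightarrow> (nat list \<Rightarrow> nat) \<Rightarrow> bool" where
  gr_zero: "general_recursive k (\<lambda>xs. 0)"
| gr_succ: "general_recursive 1 (\<lambda>xs. Suc (xs ! 0))"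
| gr_proj: "i < k \<Longrightarrow> general_recursive k (\<lambda>xs. xs ! i)"
| gr_comp: "general_recursive (length gs) f \<Longrightarrow> (\<forall>g\<in>set gs. general_recursive k g) \<Longrightarrow>
    general_recursive k (\<lambda>xs. f (map (\<lambda>g. g xs) gs))"
| gr_prec: "general_recursive k f \<Longrightarrow> general_recursive (k + 2) g \<Longrightarrow>
    general_recursive (Suc k)
      (\<lambda>xs. rec_nat (f (tl xs)) (\<lambda>y v. g (y # v # tl xs)) (hd xs))"
| gr_mu: "general_recursive (Suc k) f \<Longrightarrow> (\<forall>xs. length xs = k \<longrightarrow> (\<exists>y. f (y # xs) = 0)) \<Longrightarrow>
    general_recursive k (\<lambda>xs. LEAST y. f (y # xs) = 0)"

text \<open>
  A real constant depending on two natural parameters is effectively computable if a single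
  algorithm, given the parameters \<open>r\<close>, \<open>s\<close> and a precision \<open>k\<close>, outputs a rational number
  \<open>(a - b) / (d + 1)\<close> within \<open>2\<^sup>-\<^sup>k\<close> of the constant.
\<close>

definition effectively_computable :: "(nat \<Rightarrow> nat \<Rightarrow> real) \<Rightarrow> bool" where
  "effectively_computable C \<longleftrightarrow>
    (\<exists>a b d. general_recursive 3 a \<and> general_recursive 3 b \<and> general_recursive 3 d \<and>
      (\<forall>r s k. \<bar>C r s - (real (a [r, s, k]) - real (b [r, s, k])) / real (Suc (d [r, s, k]))\<bar>
                 \<le> 1 / 2 ^ k))"

end

theory Submission
  imports Defs
begin

text \<open>
  A greedy choice works. Consecutive \<open>r\<close>-th powers near \<open>n\<close> differ by \<open>O(n\<^bsup>1-1/r\<^esup>)\<close>, so the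
  largest \<open>A\<^bsup>r\<^esup> \<le> n\<close> leaves a remainder \<open>R = O(n\<^bsup>1-1/r\<^esup>)\<close>; the smallest \<open>B\<^bsup>s\<^esup> \<ge> R\<close> then
  overshoots \<open>R\<close> by \<open>O(R\<^bsup>1-1/s\<^esup>) = O(n\<^bsup>(1-1/r)(1-1/s)\<^esup>)\<close>. The constant \<open>2\<^bsup>r+s\<^esup>\<close> suffices.
\<close>

text \<open>The extra \<open>x ^ k\<close> on the left makes the induction go through.\<close>

lemma power_Suc_gap:
  fixes x k :: nat
  assumes "1 \<le> x"
  shows "(x + 1) ^ Suc k + x ^ k \<le> x ^ Suc k + 2 ^ Suc k * x ^ k"
proof (induction k)
  case 0
  then show ?case by simp
next
  case (Suc k)
  \<comment> \<open>Setting \<open>p\<close> = 2^(k+1) - 1 lets the extra \<open>x ^ k\<close>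
    cancel in the induction hypothesis without truncated subtraction.\<close>
  obtain p :: nat where p: "2 ^ Suc k = p + 1"
    using not0_implies_Suc[of "2 ^ Suc k"] by auto
  have "(x + 1) ^ Suc k \<le> x ^ Suc k + p * x ^ k"
    using Suc.IH unfolding p by simp
  then have "(x + 1) ^ Suc (Suc k) \<le> (x + 1) * (x ^ Suc k + p * x ^ k)"
    unfolding power_Suc[of "x + 1" "Suc k"] by (rule mult_le_mono2)
  also have "\<dots> = x ^ Suc (Suc k) + x ^ Suc k + p * x ^ Suc k + p * x ^ k"
    by (simp add: algebra_simps)
  \<comment> \<open>The coefficients of \<open>x ^ Suc k\<close> now add up to 1 + 2p = 2^(k+2) - 1,
    which leaves exactly the extra term of the claim.\<close>
  also have "p * x ^ k \<le> p * x ^ Suc k"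
    using assms by simp
  finally show ?case
    unfolding power_Suc[of 2 "Suc k"] p by (simp add: distrib_right)
qed

lemma ex_nat_root:
  fixes r n :: nat
  assumes "0 < r"
  obtains a where "a ^ r \<le> n" and "n < (a + 1) ^ r"
proof -
  have "n < Suc n ^ r"
    using assms self_le_power[of "Suc n" r] by simp
  then obtain a where "\<forall>i\<le>a. \<not> n < i ^ r" "n < Suc a ^ r"
    using ex_least_nat_less[of "\<lambda>i. n < i ^ r" "Suc n"] assms by (auto simp: zero_power)
  then show thesis
    using that[of a] by auto
qed

lemma power_pred_le_powr:
  fixes a n r :: nat
  assumes "0 < r" and "1 \<le> a" and "a ^ r \<le> n"
  shows "real (a ^ (r - 1)) \<le> real n powr ((real r - 1) / real r)"
proof -
  have "real (a ^ (r - 1)) = real a powr (real r * ((real r - 1) / real r))"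
    using assms by (simp add: powr_realpow[symmetric] of_nat_diff)
  also have "\<dots> = real (a ^ r) powr ((real r - 1) / real r)"
    using assms unfolding powr_powr[symmetric] by (simp add: powr_realpow)
  also have "\<dots> \<le> real n powr ((real r - 1) / real r)"
    using assms by (intro powr_mono2) (auto simp del: of_nat_power)
  finally show ?thesis .
qed

text \<open>Any \<open>n\<close> above \<open>a ^ r\<close> is allowed, so the same bound serves for
  rounding \<open>n\<close> down and for rounding it up to a power.\<close>

lemma consecutive_power_gap:
  fixes a n r :: nat
  assumes "0 < r" and "1 \<le> a" and "a ^ r \<le> n"
  shows "real ((a + 1) ^ r) \<le> real (a ^ r) + 2 ^ r * real n powr ((real r - 1) / real r)"
proof -
  have "(a + 1) ^ r \<le> a ^ r + 2 ^ r * a ^ (r - 1)"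
    using power_Suc_gap[OF assms(2), of "r - 1"] assms(1) by simp
  then have "real ((a + 1) ^ r) \<le> real (a ^ r + 2 ^ r * a ^ (r - 1))"
    by (simp only: of_nat_le_iff)
  also have "\<dots> = real (a ^ r) + 2 ^ r * real (a ^ (r - 1))"
    by simp
  also have "\<dots> \<le> real (a ^ r) + 2 ^ r * real n powr ((real r - 1) / real r)"
    using power_pred_le_powr[OF assms] by (intro add_left_mono mult_left_mono) auto
  finally show ?thesis .
qed

lemma power_below:
  fixes n r :: nat
  assumes "0 < r" and "0 < n"
  obtains a where "a ^ r \<le> n" and "real (n - a ^ r) \<le> 2 ^ r * real n powr ((real r - 1) / real r)"
proof -
  obtain a where a: "a ^ r \<le> n" "n < (a + 1) ^ r"
    using ex_nat_root[OF assms(1)] .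
  have "1 \<le> a"
    using a(2) assms by (cases a) auto
  from consecutive_power_gap[OF assms(1) this a(1)] a
  have "real (n - a ^ r) \<le> 2 ^ r * real n powr ((real r - 1) / real r)"
    using of_nat_less_iff[where 'a = real, THEN iffD2, OF a(2)]
    unfolding of_nat_diff[OF a(1)] by linarith
  with a(1) show thesis by (rule that)
qed

lemma power_above:
  fixes n s :: nat
  assumes "0 < s"
  obtains b where "n \<le> b ^ s" and "real (b ^ s - n) \<le> 2 ^ s * real n powr ((real s - 1) / real s)"
proof (cases "n \<le> 1")
  \<comment> \<open>Here the root \<open>a\<close> used below would be 0, outside the gap bound; but
    0 and 1 are themselves \<open>s\<close>-th powers.\<close>
  case True
  then show thesis using that[of n] assms by (cases n) (auto simp: zero_power)
next
  case False
  \<comment> \<open>Taking the root of \<open>n - 1\<close> makes \<open>a + 1\<close> the least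
    base whose \<open>s\<close>-th power reaches \<open>n\<close>.\<close>
  obtain a where a: "a ^ s \<le> n - 1" "n - 1 < (a + 1) ^ s"
    using ex_nat_root[OF assms] .
  have "1 \<le> a"
    using a(2) False by (cases a) auto
  have le: "a ^ s \<le> n" "n \<le> (a + 1) ^ s"
    using a by linarith+
  have "real ((a + 1) ^ s - n) \<le> 2 ^ s * real n powr ((real s - 1) / real s)"
    using consecutive_power_gap[OF assms \<open>1 \<le> a\<close> le(1)] le
      of_nat_le_iff[where 'a = real, THEN iffD2, OF le(1)]
    unfolding of_nat_diff[OF le(2)] by linarith
  with le(2) show thesis by (rule that)
qed

lemma sum_of_powers_in_short_interval:
  fixes r s n :: nat
  assumes "0 < r" and "0 < s"
  obtains a b where "n \<le> a ^ r + b ^ s"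
    and "real (a ^ r + b ^ s) \<le> real n +
      2 ^ (r + s) * real n powr (((real r - 1) * (real s - 1)) / (real r * real s))"
proof (cases "n = 0")
  \<comment> \<open>Since \<open>0 powr x = 0\<close> for every \<open>x\<close>, even
    \<open>x = 0\<close>, the interval is the single point 0.\<close>
  case True
  then show thesis using that[of 0 0] assms by (simp add: zero_power)
next
  case False
  define \<beta> where "\<beta> = (real r - 1) / real r"
  define \<gamma> where "\<gamma> = (real s - 1) / real s"
  have \<gamma>: "0 \<le> \<gamma>" "\<gamma> \<le> 1"
    using assms by (auto simp: \<gamma>_def)
  obtain a where a: "a ^ r \<le> n" "real (n - a ^ r) \<le> 2 ^ r * real n powr \<beta>"
    using power_below[of r n] assms False unfolding \<beta>_def by auto
  define R where "R = n - a ^ r"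
  obtain b where b: "R \<le> b ^ s" "real (b ^ s - R) \<le> 2 ^ s * real R powr \<gamma>"
    using power_above[of s R] assms unfolding \<gamma>_def by auto
  have "real R powr \<gamma> \<le> (2 ^ r * real n powr \<beta>) powr \<gamma>"
    using a \<gamma> by (intro powr_mono2) (auto simp: R_def)
  also have "\<dots> = (2 ^ r) powr \<gamma> * real n powr (\<beta> * \<gamma>)"
    by (simp add: powr_mult powr_powr)
  \<comment> \<open>As \<gamma> \<le> 1 and \<open>2 ^ r\<close> is at least 1, the factor from the
    first rounding grows to at most \<open>2 ^ r\<close>; hence the constant
    \<open>2 ^ (r + s)\<close>.\<close>
  also have "\<dots> \<le> (2 ^ r) powr 1 * real n powr (\<beta> * \<gamma>)"
    using \<gamma> by (intro mult_right_mono powr_mono) auto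
  finally have "2 ^ s * real R powr \<gamma> \<le> 2 ^ s * (2 ^ r * real n powr (\<beta> * \<gamma>))"
    by simp
  with b(2) have "real (b ^ s - R) \<le> 2 ^ s * (2 ^ r * real n powr (\<beta> * \<gamma>))"
    by (rule order_trans)
  then have "real (b ^ s - R) \<le> 2 ^ (r + s) * real n powr (\<beta> * \<gamma>)"
    by (simp add: power_add mult_ac)
  moreover have "a ^ r + b ^ s = n + (b ^ s - R)"
    using a(1) b(1) by (simp add: R_def)
  ultimately show thesis
    using that[of a b] by (simp add: \<beta>_def \<gamma>_def del: of_nat_power)
qed

text \<open>Two successors per recursion step give doubling directly, without first building
  addition or multiplication.\<close>

lemma general_recursive_double:
  "general_recursive 1 (\<lambda>xs. rec_nat 0 (\<lambda>y v. Suc (Suc v)) (hd xs))"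
proof -
  have "general_recursive 2 (\<lambda>xs. Suc (xs ! 1))"
    using gr_comp[of "[\<lambda>xs. xs ! 1]" "\<lambda>xs. Suc (xs ! 0)" 2] gr_succ gr_proj[of 1 2] by simp
  then have "general_recursive 2 (\<lambda>xs. Suc (Suc (xs ! 1)))"
    using gr_comp[of "[\<lambda>xs. Suc (xs ! 1)]" "\<lambda>xs. Suc (xs ! 0)" 2] gr_succ by simp
  then show ?thesis
    using gr_prec[OF gr_zero[of 0], of "\<lambda>xs. Suc (Suc (xs ! 1))"] by (simp add: numeral_2_eq_2)
qed

text \<open>Primitive recursion on a new first argument starts from \<open>f\<close> and doubles at
  each step. Applied twice, it yields \<open>2 ^ (r + s)\<close>.\<close>

lemma general_recursive_shift_left:
  assumes "general_recursive k f"
  obtains h where "general_recursive (Suc k) h" and "\<And>x xs. h (x # xs) = 2 ^ x * f xs"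
proof -
  define dbl :: "nat list \<Rightarrow> nat" where "dbl = (\<lambda>xs. rec_nat 0 (\<lambda>y v. Suc (Suc v)) (hd xs))"
  have dbl: "dbl [x] = 2 * x" for x
    unfolding dbl_def by (induction x) auto
  \<comment> \<open>The step function receives the counter, the accumulated value and the
    parameters; index 1 selects the accumulated value.\<close>
  have "general_recursive (k + 2) (\<lambda>xs. dbl [xs ! 1])"
    using gr_comp[of "[\<lambda>xs. xs ! 1]" dbl "k + 2"] general_recursive_double gr_proj[of 1 "k + 2"]
    by (simp add: dbl_def)
  from gr_prec[OF assms this]
  have "general_recursive (Suc k) (\<lambda>xs. rec_nat (f (tl xs)) (\<lambda>y v. 2 * v) (hd xs))"
    by (simp add: dbl)
  moreover have "rec_nat (f xs) (\<lambda>y v. 2 * v) x = 2 ^ x * f xs" for x xs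
    by (induction x) auto
  ultimately show thesis
    by (intro that) auto
qed

lemma effectively_computable_two_power_add:
  "effectively_computable (\<lambda>r s. 2 ^ (r + s))"
proof -
  \<comment> \<open>The single argument of this constant is the precision \<open>k\<close>;
    \<open>f\<close> then consumes \<open>s\<close>, and \<open>h\<close> consumes
    \<open>r\<close>.\<close>
  have one: "general_recursive 1 (\<lambda>xs. Suc 0)"
    using gr_comp[of "[\<lambda>xs. 0]" "\<lambda>xs. Suc (xs ! 0)" 1] gr_succ gr_zero by simp
  obtain f where f: "general_recursive (Suc 1) f" "\<And>x xs. f (x # xs) = 2 ^ x * Suc 0"
    using general_recursive_shift_left[OF one] by blast
  obtain h where h: "general_recursive (Suc (Suc 1)) h" "\<And>x xs. h (x # xs) = 2 ^ x * f xs"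
    using general_recursive_shift_left[OF f(1)] by blast
  have "general_recursive 3 h"
    using h(1) by (simp add: numeral_3_eq_3)
  moreover have "h [r, s, k] = 2 ^ (r + s)" for r s k
    by (simp add: h f power_add)
  \<comment> \<open>The constant is a natural number, so the approximation (h - 0) / (0 + 1) is
    exact at every precision.\<close>
  ultimately show ?thesis
    unfolding effectively_computable_def
    by (intro exI[of _ h] exI[of _ "\<lambda>xs. 0"]) (simp add: gr_zero)
qed

theorem theorem1p1:
  "\<exists>C :: nat \<Rightarrow> nat \<Rightarrow> real. effectively_computable C \<and>
    (\<forall>r s :: nat. 0 < r \<longrightarrow> 0 < s \<longrightarrow>
      0 < C r s \<and>
      (\<forall>n :: nat. \<exists>m :: int.
        real_of_int m \<in> {real n .. real n +
          C r s * real n powr (((real r - 1) * (real s - 1)) / (real r * real s))} \<and>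
        (\<exists>A B :: int. m = A ^ r + B ^ s)))"
proof (intro exI[of _ "\<lambda>r s. 2 ^ (r + s)"] conjI allI impI)
  show "effectively_computable (\<lambda>r s. 2 ^ (r + s))"
    by (rule effectively_computable_two_power_add)
next
  fix r s n :: nat
  assume "0 < r" "0 < s"
  then obtain a b where ab: "n \<le> a ^ r + b ^ s"
    "real (a ^ r + b ^ s) \<le> real n +
      2 ^ (r + s) * real n powr (((real r - 1) * (real s - 1)) / (real r * real s))"
    by (rule sum_of_powers_in_short_interval)
  have "real n \<le> real (a ^ r + b ^ s)"
    using ab(1) by (simp only: of_nat_le_iff)
  with ab(2) show "\<exists>m :: int.
      real_of_int m \<in> {real n .. real n +
        2 ^ (r + s) * real n powr (((real r - 1) * (real s - 1)) / (real r * real s))} \<and>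
      (\<exists>A B :: int. m = A ^ r + B ^ s)"
    by (intro exI[of _ "int (a ^ r + b ^ s)"] conjI exI[of _ "int a"] exI[of _ "int b"]) auto
qed simp

end
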